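(* Let $N \ge 1$ be an integer, let $A$ and $B$ be matrices in the unitary group $U(N)$, and let $J$ and $K$ be positive integers. If $$\delta_{J,K}(A,B) = \min\big\{\varphi(A^j B^k) : j, k \in \mathbb{Z},\ |j| \le J,\ |k| \le K,\ \text{and } (j,k) \ne (0,0)\big\},$$ then $$\delta_{J,K}(A,B) \le 2\pi\, (J+1)^{-1/N^2} (K+1)^{-1/N^2}.$$
   Context: $U(N)$ is the group of $N \times N$ complex unitary matrices. For a (column) vector $\boldsymbol{x} \in \mathbb{C}^N$, $|\boldsymbol{x}|_2 = (|x_1|^2 + \cdots + |x_N|^2)^{1/2}$ is the standard Hermitian norm, and $X = \{\boldsymbol{x} \in \mathbb{C}^N : |\boldsymbol{x}|_2 = 1\}$. The function $\varphi : U(N) \to [0,\infty)$ is defined by $\varphi(A) = \sup\{|A\boldsymbol{x} - \boldsymbol{x}|_2 : \boldsymbol{x} \in X\}$. *)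

theory Defs
  imports "HOL-Analysis.Analysis" "HOL-Algebra.Group"
begin

definition conj_transpose :: "complex^'n^'m \<Rightarrow> complex^'m^'n" where
  "conj_transpose A = (\<chi> i j. cnj (A $ j $ i))"

definition unitary :: "complex^'n^'n \<Rightarrow> bool" where
  "unitary A \<longleftrightarrow> conj_transpose A ** A = mat 1 \<and> A ** conj_transpose A = mat 1"

text \<open>The type class power on \<open>complex^'n^'n\<close> is componentwise, so integer powers of matrices
  are taken in the following group \<open>U(N)\<close>, where \<open>N = CARD('n)\<close>.\<close>

definition unitary_group :: "(complex^'n^'n) monoid" where
  "unitary_group = \<lparr>carrier = {A. unitary A}, mult = (**), one = mat 1\<rparr>"

lemma unitary_group_simps [simp]:
  "A \<in> carrier unitary_group \<longleftrightarrow> unitary A"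
  "A \<otimes>\<^bsub>unitary_group\<^esub> B = A ** B"
  "\<one>\<^bsub>unitary_group\<^esub> = mat 1"
  by (simp_all add: unitary_group_def)

lemma conj_transpose_conj_transpose [simp]: "conj_transpose (conj_transpose A) = A"
  by (simp add: conj_transpose_def vec_eq_iff)

lemma conj_transpose_mat_1 [simp]: "conj_transpose (mat 1) = mat 1"
  by (auto simp: conj_transpose_def mat_def vec_eq_iff)

lemma conj_transpose_mult: "conj_transpose (A ** B) = conj_transpose B ** conj_transpose A"
  by (simp add: conj_transpose_def matrix_matrix_mult_def vec_eq_iff mult.commute)

lemma unitary_mat_1 [simp]: "unitary (mat 1)"
  by (simp add: unitary_def)

lemma unitary_conj_transpose: "unitary A \<Longrightarrow> unitary (conj_transpose A)"
  by (simp add: unitary_def)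

lemma unitary_mult:
  assumes "unitary A" "unitary B"
  shows "unitary (A ** B)"
proof -
  have "conj_transpose B ** conj_transpose A ** (A ** B)
      = conj_transpose B ** (conj_transpose A ** A) ** B"
    by (simp add: matrix_mul_assoc)
  moreover have "A ** B ** (conj_transpose B ** conj_transpose A)
      = A ** (B ** conj_transpose B) ** conj_transpose A"
    by (simp add: matrix_mul_assoc)
  ultimately show ?thesis
    using assms by (simp add: unitary_def conj_transpose_mult)
qed

lemma group_unitary_group: "group (unitary_group :: (complex^'n^'n) monoid)"
proof (rule groupI)
  fix A :: "complex^'n^'n"
  assume "A \<in> carrier unitary_group"
  then show "\<exists>B\<in>carrier unitary_group. B \<otimes>\<^bsub>unitary_group\<^esub> A = \<one>\<^bsub>unitary_group\<^esub>"
    by (intro bexI[of _ "conj_transpose A"])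
      (simp_all add: unitary_conj_transpose, simp add: unitary_def)
qed (simp_all add: unitary_mult matrix_mul_assoc)

definition \<phi> :: "complex^'n^'n \<Rightarrow> real" where
  "\<phi> A = (SUP x\<in>{x. norm x = 1}. norm (A *v x - x))"

text \<open>The supremum of reals in \<open>\<phi>\<close> is over a nonempty bounded set, hence a true supremum.\<close>

lemma unit_vectors_nonempty: "{x :: complex^'n. norm x = 1} \<noteq> {}"
  using vector_choose_size[of 1, where 'a = "complex^'n"] by auto

lemma bdd_above_displacement:
  "bdd_above ((\<lambda>x. norm (A *v x - x)) ` {x :: complex^'n. norm x = 1})"
proof -
  have "bounded_linear (\<lambda>x. A *v x - x)"
    by (intro bounded_linear_sub matrix_vector_mul_bounded_linear bounded_linear_ident)
  then obtain C where "\<And>x. norm (A *v x - x) \<le> norm x * C"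
    using bounded_linear.bounded by blast
  then show ?thesis
    by (intro bdd_aboveI2[of _ _ C]) (metis mem_Collect_eq mult_1)
qed

definition exponent_pairs :: "nat \<Rightarrow> nat \<Rightarrow> (int \<times> int) set" where
  "exponent_pairs J K = {(j, k). \<bar>j\<bar> \<le> int J \<and> \<bar>k\<bar> \<le> int K \<and> (j, k) \<noteq> (0, 0)}"

definition \<delta> :: "nat \<Rightarrow> nat \<Rightarrow> complex^'n^'n \<Rightarrow> complex^'n^'n \<Rightarrow> real" where
  "\<delta> J K A B = Min ((\<lambda>(j, k). \<phi> (A [^]\<^bsub>unitary_group\<^esub> j \<otimes>\<^bsub>unitary_group\<^esub> B [^]\<^bsub>unitary_group\<^esub> k))
                      ` exponent_pairs J K)"

lemma finite_exponent_pairs: "finite (exponent_pairs J K)"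
proof (rule finite_subset)
  show "exponent_pairs J K \<subseteq> {- int J..int J} \<times> {- int K..int K}"
    by (auto simp: exponent_pairs_def)
qed simp

lemma exponent_pairs_nonempty: "J > 0 \<Longrightarrow> exponent_pairs J K \<noteq> {}"
proof -
  assume "J > 0"
  then have "(1, 0) \<in> exponent_pairs J K"
    by (simp add: exponent_pairs_def)
  then show ?thesis
    by blast
qed

end

theory Submission
  imports Defs
begin

text \<open>The proof is a pigeonhole argument. The \<open>M = (J+1)(K+1)\<close> products \<open>A\<^sup>j B\<^sup>k\<close> with \<open>0 \<le> j \<le> J\<close> and
  \<open>0 \<le> k \<le> K\<close> lie in the compact group \<open>U(N)\<close> of dimension \<open>N\<^sup>2\<close>, and the distance of two of them
  is a value \<open>\<phi>(A\<^sup>j B\<^sup>k)\<close> at differences of exponents. If all these distances exceed \<open>2 \<pi> s\<close>, then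
  the balls of radius \<open>\<pi> s\<close> about the products are disjoint. Each of them fills at least the
  fraction \<open>s\<^bsup>N\<^sup>2\<^esup>\<close> of the group, whence \<open>M s\<^bsup>N\<^sup>2\<^esup> \<le> 1\<close>, and \<open>s = M\<^bsup>-1/N\<^sup>2\<^esup>\<close> is the critical value.

  The volume of a ball could be computed from Haar measure and Weyl's integration formula. Here
  volumes are replaced by packings, and sharp constants are recovered by iteration:

  \<^item> Any two unitary matrices \<open>U = V D V\<^sup>*\<close> and \<open>U' = W E W\<^sup>*\<close> with diagonal \<open>D\<close> and \<open>E\<close> satisfy
    \<open>\<parallel>U - U'\<parallel>\<^sup>2 = \<Sum>\<^sub>i\<^sub>j |D\<^sub>i - E\<^sub>j|\<^sup>2 |(V\<^sup>*W)\<^sub>i\<^sub>j|\<^sup>2\<close> in the Frobenius norm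
    (\<open>norm_unitary_conjugate_diff_squared\<close>). Thus inequalities between chords of the unit circle
    carry over to \<open>U(N)\<close>.

  \<^item> For angles in \<open>[-\<pi>, \<pi>]\<close>, multiplying the angles by \<open>s\<close> shrinks chords by the factor \<open>s\<close> at
    most. So all of \<open>U(N)\<close> can be mapped into the ball of radius \<open>\<pi> s\<close> about the identity with
    distances shrinking by at most \<open>s\<close> (\<open>unitary_contraction\<close>).

  \<^item> Placing a contracted copy of a separated set at each of the \<open>M\<close> products multiplies its
    cardinality by \<open>M\<close> and its separation by \<open>s\<close>. After \<open>k\<close> rounds there are \<open>M\<^sup>k\<close> points of
    separation \<open>\<eta> s\<^sup>k\<close> (\<open>separated_translates\<close>), while a set of separation \<open>e \<le> 1\<close> in \<open>U(N)\<close> has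
    at most \<open>C e\<^bsup>-N\<^sup>2\<^esup>\<close> elements (\<open>separated_unitary_family_card_le\<close>). As \<open>k\<close> tends to infinity the
    constants disappear and \<open>M s\<^bsup>N\<^sup>2\<^esup> \<le> 1\<close> remains (\<open>separated_family_volume_bound\<close>).\<close>

section \<open>Hermitian and Frobenius norms\<close>

definition hermitian_product :: "complex^'n \<Rightarrow> complex^'n \<Rightarrow> complex" where
  "hermitian_product x y = (\<Sum>i\<in>UNIV. cnj (x $ i) * y $ i)"

lemma hermitian_product_commute: "hermitian_product y x = cnj (hermitian_product x y)"
  by (simp add: hermitian_product_def mult.commute)

lemma hermitian_product_sesquilinear:
  "hermitian_product x (y + z) = hermitian_product x y + hermitian_product x z"
  "hermitian_product (y + z) x = hermitian_product y x + hermitian_product z x"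
  "hermitian_product x (c *s y) = c * hermitian_product x y"
  "hermitian_product (c *s x) y = cnj c * hermitian_product x y"
  by (simp_all add: hermitian_product_def algebra_simps sum.distrib sum_distrib_left)

lemma hermitian_product_self: "hermitian_product x x = of_real ((norm x)\<^sup>2)"
  unfolding hermitian_product_def norm_vec_def L2_set_def
  by (simp add: sum_nonneg complex_norm_square mult.commute flip: of_real_power)

lemma inner_eq_Re_hermitian_product: "x \<bullet> y = Re (hermitian_product x y)"
  by (simp add: hermitian_product_def inner_vec_def inner_complex_def)

lemma hermitian_product_matrix:
  "hermitian_product x (A *v y) = hermitian_product (conj_transpose A *v x) y"
proof -
  have "hermitian_product x (A *v y) = (\<Sum>i\<in>UNIV. \<Sum>j\<in>UNIV. cnj (x $ i) * (A $ i $ j * y $ j))"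
    by (simp add: hermitian_product_def matrix_vector_mult_def sum_distrib_left)
  also have "\<dots> = (\<Sum>j\<in>UNIV. \<Sum>i\<in>UNIV. cnj (x $ i) * (A $ i $ j * y $ j))"
    by (rule sum.swap)
  also have "\<dots> = hermitian_product (conj_transpose A *v x) y"
    by (simp add: hermitian_product_def matrix_vector_mult_def conj_transpose_def
        sum_distrib_left sum_distrib_right mult_ac)
  finally show ?thesis .
qed

lemma norm_unitary_vector:
  assumes "unitary U"
  shows "norm (U *v x) = norm x"
proof -
  have "hermitian_product (U *v x) (U *v x) = hermitian_product x x"
    using assms by (simp add: hermitian_product_matrix matrix_vector_mul_assoc unitary_def)
  then have "(norm (U *v x))\<^sup>2 = (norm x)\<^sup>2"
    unfolding hermitian_product_self of_real_eq_iff .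
  then show ?thesis
    by simp
qed

lemma norm_vector_smult: "norm (c *s x) = cmod c * norm (x :: complex^'n)"
  by (simp add: norm_vec_def norm_mult L2_set_right_distrib)

lemma norm_matrix_squared:
  fixes A :: "'a::real_normed_vector^'n^'m"
  shows "(norm A)\<^sup>2 = (\<Sum>i\<in>UNIV. \<Sum>j\<in>UNIV. (norm (A $ i $ j))\<^sup>2)"
  by (simp add: norm_vec_def L2_set_def sum_nonneg)

lemma norm_conj_transpose: "norm (conj_transpose A) = norm A"
proof -
  have "(norm (conj_transpose A))\<^sup>2 = (norm A)\<^sup>2"
    unfolding norm_matrix_squared by (subst sum.swap) (simp add: conj_transpose_def)
  then show ?thesis by simp
qed

lemma norm_matrix_squared_columns: "(norm (A :: complex^'n^'m))\<^sup>2 = (\<Sum>j\<in>UNIV. (norm (column j A))\<^sup>2)"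
  unfolding norm_matrix_squared 
  by (subst sum.swap) (simp add: norm_vec_def L2_set_def sum_nonneg column_def)

lemma norm_unitary_mult_left:
  assumes "unitary U"
  shows "norm (U ** A) = norm A"
proof -
  have "column j (U ** A) = U *v column j A" for j
    by (simp add: column_def matrix_matrix_mult_def matrix_vector_mult_def vec_eq_iff)
  then have "(norm (U ** A))\<^sup>2 = (norm A)\<^sup>2"
    unfolding norm_matrix_squared_columns by (simp add: norm_unitary_vector[OF assms])
  then show ?thesis by simp
qed

lemma norm_unitary_mult_right:
  assumes "unitary U"
  shows "norm (A ** U) = norm A"
  using norm_unitary_mult_left[OF unitary_conj_transpose[OF assms], of "conj_transpose A"]
  by (metis conj_transpose_mult norm_conj_transpose)

lemma norm_matrix_vector_le: "norm ((A :: complex^'n^'m) *v x) \<le> norm A * norm x"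
proof -
  have "(norm (A *v x))\<^sup>2 \<le> (\<Sum>i\<in>UNIV. (norm (A $ i))\<^sup>2 * (norm x)\<^sup>2)"
  proof -
    have "cmod ((A *v x) $ i) \<le> norm (A $ i) * norm x" for i
    proof -
      have "cmod ((A *v x) $ i) \<le> (\<Sum>j\<in>UNIV. \<bar>cmod (A $ i $ j)\<bar> * \<bar>cmod (x $ j)\<bar>)"
        unfolding matrix_vector_mult_def by (auto intro!: sum_norm_le simp: norm_mult)
      also have "\<dots> \<le> norm (A $ i) * norm x"
        unfolding norm_vec_def by (rule L2_set_mult_ineq)
      finally show ?thesis .
    qed
    then show ?thesis
      unfolding norm_vec_def[of "A *v x"] L2_set_def
      by (auto simp: sum_nonneg power_mult_distrib[symmetric] intro!: sum_mono power_mono)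
  qed
  also have "\<dots> = (norm A * norm x)\<^sup>2"
    by (simp add: norm_vec_def[of A] L2_set_def sum_nonneg power_mult_distrib sum_distrib_right)
  finally show ?thesis
    by (rule power2_le_imp_le) simp
qed

section \<open>Spectral functions of unitary matrices\<close>

definition diagonal :: "('n \<Rightarrow> complex) \<Rightarrow> complex^'n^'n" where
  "diagonal d = (\<chi> i j. if i = j then d i else 0)"

lemma diagonal_mult_entry: "(diagonal d ** A) $ i $ j = d i * A $ i $ j"
  by (simp add: diagonal_def matrix_matrix_mult_def if_distrib[where f="\<lambda>x. x * _"] cong: if_cong)

lemma mult_diagonal_entry: "(A ** diagonal d) $ i $ j = A $ i $ j * d j"
  by (simp add: diagonal_def matrix_matrix_mult_def if_distrib[where f="\<lambda>x. _ * x"] cong: if_cong)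

lemma diagonal_vector_entry: "(diagonal d *v x) $ i = d i * x $ i"
  by (simp add: diagonal_def matrix_vector_mult_def if_distrib[where f="\<lambda>x. x * _"] cong: if_cong)

lemma conj_transpose_diagonal: "conj_transpose (diagonal d) = diagonal (\<lambda>i. cnj (d i))"
  by (auto simp: conj_transpose_def diagonal_def vec_eq_iff)

lemma matrix_diff_distribs:
  fixes A B :: "complex^'n^'m" and C D :: "complex^'p^'n"
  shows "A ** (C - D) = A ** C - A ** D" "(A - B) ** C = A ** C - B ** C"
  by (simp_all add: matrix_matrix_mult_def vec_eq_iff algebra_simps sum_subtractf)

definition unitary_conjugate :: "complex^'n^'n \<Rightarrow> ('n \<Rightarrow> complex) \<Rightarrow> complex^'n^'n" where
  "unitary_conjugate V d = V ** diagonal d ** conj_transpose V"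

lemma unitary_unitary_conjugate:
  assumes "unitary V" "\<And>i. cmod (d i) = 1"
  shows "unitary (unitary_conjugate V d)"
proof -
  have "cnj (d i) * d i = 1" "d i * cnj (d i) = 1" for i
    using assms(2)[of i] complex_norm_square[of "d i"] by (simp_all add: mult.commute)
  then have "unitary (diagonal d)"
    unfolding unitary_def conj_transpose_diagonal
    by (auto simp: vec_eq_iff diagonal_mult_entry) (auto simp: diagonal_def mat_def)
  then show ?thesis
    unfolding unitary_conjugate_def by (intro unitary_mult unitary_conj_transpose assms)
qed

text \<open>The key identity. Multiplying by \<open>V\<^sup>*\<close> on the left and by \<open>W\<close> on the right does not change
  the Frobenius norm and turns both matrices into diagonal ones on either side of \<open>P = V\<^sup>*W\<close>.
  The weights \<open>|P\<^sub>i\<^sub>j|\<^sup>2\<close> do not depend on the spectral functions \<open>d\<close> and \<open>e\<close>, so that every scalar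
  comparison of spectra becomes a comparison of matrices.\<close>
lemma norm_unitary_conjugate_diff_squared:
  assumes "unitary V" "unitary W"
  shows "(norm (unitary_conjugate V d - unitary_conjugate W e))\<^sup>2
       = (\<Sum>i\<in>UNIV. \<Sum>j\<in>UNIV. (cmod (d i - e j))\<^sup>2 * (cmod ((conj_transpose V ** W) $ i $ j))\<^sup>2)"
proof -
  let ?P = "conj_transpose V ** W" and ?D = "unitary_conjugate V d - unitary_conjugate W e"
  have V: "conj_transpose V ** V = mat 1" and W: "conj_transpose W ** W = mat 1"
    using assms by (simp_all add: unitary_def)
  have "conj_transpose V ** ?D ** W
      = conj_transpose V ** V ** diagonal d ** ?P - ?P ** diagonal e ** (conj_transpose W ** W)"
    by (simp add: unitary_conjugate_def matrix_diff_distribs matrix_mul_assoc)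
  then have eq: "conj_transpose V ** ?D ** W = diagonal d ** ?P - ?P ** diagonal e"
    by (simp add: V W)
  have "(conj_transpose V ** ?D ** W) $ i $ j = (d i - e j) * ?P $ i $ j" for i j
    unfolding eq by (simp add: diagonal_mult_entry mult_diagonal_entry algebra_simps)
  moreover have "norm ?D = norm (conj_transpose V ** ?D ** W)"
    by (simp add: norm_unitary_mult_right norm_unitary_mult_left assms unitary_conj_transpose)
  ultimately show ?thesis
    by (simp add: norm_matrix_squared norm_mult power_mult_distrib)
qed

lemma norm_unitary_conjugate_diff_mono:
  assumes "unitary V" "unitary W" "0 \<le> c"
    and le: "\<And>i j. cmod (d i - e j) \<le> c * cmod (d' i - e' j)"
  shows "norm (unitary_conjugate V d - unitary_conjugate W e)
    \<le> c * norm (unitary_conjugate V d' - unitary_conjugate W e')"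
proof (rule power2_le_imp_le)
  have "(cmod (d i - e j))\<^sup>2 \<le> c\<^sup>2 * (cmod (d' i - e' j))\<^sup>2" for i j
    unfolding power_mult_distrib[symmetric] by (intro power_mono le) simp
  then show "(norm (unitary_conjugate V d - unitary_conjugate W e))\<^sup>2
    \<le> (c * norm (unitary_conjugate V d' - unitary_conjugate W e'))\<^sup>2"
    unfolding power_mult_distrib norm_unitary_conjugate_diff_squared[OF assms(1,2)]
      sum_distrib_left mult.assoc[symmetric]
    by (intro sum_mono mult_right_mono) auto
qed (use assms in simp)

lemma norm_unitary_conjugate_vector_diff_le:
  assumes "unitary V" "0 \<le> c" "\<And>i. cmod (d i - 1) \<le> c"
  shows "norm (unitary_conjugate V d *v x - x) \<le> c * norm x"
proof -
  let ?y = "conj_transpose V *v x"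
  have "V *v ?y = x"
    using assms(1) by (simp add: matrix_vector_mul_assoc unitary_def)
  then have "unitary_conjugate V d *v x - x = V *v (diagonal d *v ?y - ?y)"
    unfolding matrix_vector_mult_diff_distrib
    by (simp add: unitary_conjugate_def matrix_vector_mul_assoc matrix_mul_assoc)
  then have "norm (unitary_conjugate V d *v x - x) = norm (diagonal d *v ?y - ?y)"
    by (simp add: norm_unitary_vector assms(1))
  also have "\<dots> \<le> norm (of_real c *s ?y)"
  proof (rule norm_le_componentwise_cart)
    fix i
    have "(diagonal d *v ?y - ?y) $ i = (d i - 1) * ?y $ i"
      by (simp add: diagonal_vector_entry algebra_simps)
    then show "norm ((diagonal d *v ?y - ?y) $ i) \<le> norm ((of_real c *s ?y) $ i)"
      using assms by (simp add: norm_mult mult_right_mono)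
  qed
  also have "\<dots> = c * norm ?y"
    using \<open>0 \<le> c\<close> by (simp add: norm_vector_smult)
  also have "norm ?y = norm x"
    by (simp add: norm_unitary_vector unitary_conj_transpose assms(1))
  finally show ?thesis .
qed

section \<open>Diagonalization of unitary matrices\<close>

text \<open>First-order optimality along a line: for small \<open>t\<close> of the right sign the linear term dominates.\<close>
lemma linear_coefficient_zero_if_nonneg_quadratic:
  fixes a b :: real
  assumes "\<And>t. 0 \<le> 2 * t * a + t\<^sup>2 * b"
  shows "a = 0"
proof (rule ccontr)
  assume "a \<noteq> 0"
  define t where "t = - a / (\<bar>b\<bar> + 1)"
  have "t\<^sup>2 * b \<le> t\<^sup>2 * (\<bar>b\<bar> + 1)"
    by (intro mult_left_mono) auto
  also have "\<dots> = - t * a"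
    by (simp add: t_def power2_eq_square)
  finally have "0 \<le> t * a"
    using assms[of t] by simp
  moreover have "t * a = - (a\<^sup>2 / (\<bar>b\<bar> + 1))"
    by (simp add: t_def power2_eq_square)
  moreover have "a\<^sup>2 / (\<bar>b\<bar> + 1) > 0"
    using \<open>a \<noteq> 0\<close> by (intro divide_pos_pos) auto
  ultimately show False
    by simp
qed

text \<open>A maximizer of the quadratic form \<open>x \<bullet> H x\<close> on the unit sphere of \<open>S\<close> is an eigenvector, by
  first-order optimality. The eigenvalue is the maximum.\<close>
lemma self_adjoint_eigenvector:
  fixes S :: "'a :: euclidean_space set"
  assumes S: "subspace S" "\<exists>x\<in>S. x \<noteq> 0"
    and H: "linear H" "\<And>x. x \<in> S \<Longrightarrow> H x \<in> S" "\<And>x y. x \<bullet> H y = H x \<bullet> y"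
  obtains x c where "x \<in> S" "norm x = 1" "H x = c *\<^sub>R x"
proof -
  obtain z where z: "z \<in> S" "z \<noteq> 0" using S(2) by blast
  have "compact (S \<inter> sphere 0 1)"
    by (intro closed_Int_compact closed_subspace S) simp
  moreover have "(1 / norm z) *\<^sub>R z \<in> S \<inter> sphere 0 1"
    using z S(1) by (simp add: subspace_scale)
  moreover have "continuous_on (S \<inter> sphere 0 1) (\<lambda>x. x \<bullet> H x)"
    by (intro continuous_intros linear_continuous_on) (use H(1) in \<open>simp add: linear_conv_bounded_linear\<close>)
  ultimately have "\<exists>x\<in>S \<inter> sphere 0 1. \<forall>y\<in>S \<inter> sphere 0 1. y \<bullet> H y \<le> x \<bullet> H x"
    by (intro continuous_attains_sup) auto
  then obtain x where x: "x \<in> S" "norm x = 1"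
    and max: "\<And>y. y \<in> S \<Longrightarrow> norm y = 1 \<Longrightarrow> y \<bullet> H y \<le> x \<bullet> H x"
    by (auto simp: dist_norm)
  define c where "c = x \<bullet> H x"
  have Q: "0 \<le> c * (y \<bullet> y) - y \<bullet> H y" if "y \<in> S" for y
  proof (cases "y = 0")
    case False
    have "((1 / norm y) *\<^sub>R y) \<bullet> H ((1 / norm y) *\<^sub>R y) \<le> c"
      unfolding c_def using False that S(1) by (intro max) (auto simp: subspace_scale)
    then have "(y \<bullet> H y) / (y \<bullet> y) \<le> c"
      by (simp add: linear_scale[OF H(1)] power2_norm_eq_inner[symmetric] power2_eq_square)
    then show ?thesis
      using False by (simp add: divide_le_eq)
  qed (simp add: linear_0[OF H(1)])
  have "y \<bullet> (c *\<^sub>R x - H x) = 0" if y: "y \<in> S" for y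
  proof (rule linear_coefficient_zero_if_nonneg_quadratic)
    fix t :: real
    have sym: "x \<bullet> H y = y \<bullet> H x"
      by (metis H(3) inner_commute)
    have "x + t *\<^sub>R y \<in> S"
      by (intro subspace_add subspace_scale S x y)
    then have "0 \<le> c * ((x + t *\<^sub>R y) \<bullet> (x + t *\<^sub>R y)) - (x + t *\<^sub>R y) \<bullet> H (x + t *\<^sub>R y)"
      by (rule Q)
    also have "\<dots> = c * (x \<bullet> x) - x \<bullet> H x
      + 2 * t * (y \<bullet> (c *\<^sub>R x - H x)) + t\<^sup>2 * (c * (y \<bullet> y) - y \<bullet> H y)"
      using sym by (simp add: linear_add[OF H(1)] linear_scale[OF H(1)] inner_simps
          algebra_simps power2_eq_square inner_commute[of y x])
    also have "c * (x \<bullet> x) - x \<bullet> H x = 0"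
      using x by (simp add: c_def power2_norm_eq_inner[symmetric])
    finally show "0 \<le> 2 * t * (y \<bullet> (c *\<^sub>R x - H x)) + t\<^sup>2 * (c * (y \<bullet> y) - y \<bullet> H y)"
      by simp
  qed
  moreover have "c *\<^sub>R x - H x \<in> S"
    by (intro subspace_diff subspace_scale S x H)
  ultimately have "c *\<^sub>R x - H x = 0"
    by (metis inner_eq_zero_iff)
  then show thesis
    using that[OF x, of c] by simp
qed

text \<open>The self-adjoint operator \<open>U + U\<^sup>*\<close> has an eigenvector \<open>x\<close> in \<open>S\<close>, with real eigenvalue \<open>c\<close>.
  As \<open>U U\<^sup>* = 1\<close>, applying \<open>U\<close> gives \<open>(U\<^sup>2 - c U + 1) x = 0\<close>. If \<open>l\<close> is a root of \<open>t\<^sup>2 - c t + 1\<close>,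
  the other root is \<open>c - l\<close>; hence either \<open>x\<close> itself is an eigenvector of \<open>U\<close> for \<open>l\<close>, or
  \<open>U x - l x\<close> is one for \<open>c - l\<close>.\<close>
lemma unitary_eigenvector:
  fixes U :: "complex^'n^'n"
  assumes U: "unitary U"
    and S: "subspace S" "\<And>c x. x \<in> S \<Longrightarrow> c *s x \<in> S" "\<exists>x\<in>S. x \<noteq> 0"
    and inv: "\<And>x. x \<in> S \<Longrightarrow> U *v x \<in> S" "\<And>x. x \<in> S \<Longrightarrow> conj_transpose U *v x \<in> S"
  obtains x l where "x \<in> S" "norm x = 1" "U *v x = l *s x" "cmod l = 1"
proof -
  note found = that
  let ?H = "\<lambda>x. U *v x + conj_transpose U *v x"
  have "linear ?H"
    by (intro linear_compose_add matrix_vector_mul_linear)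
  moreover have "?H x \<in> S" if "x \<in> S" for x
    by (intro subspace_add S inv that)
  moreover have "x \<bullet> ?H y = ?H x \<bullet> y" for x y
    by (simp add: inner_add_left inner_add_right inner_eq_Re_hermitian_product hermitian_product_matrix
        hermitian_product_sesquilinear)
  ultimately obtain x c where x: "x \<in> S" "norm x = 1" "?H x = c *\<^sub>R x"
    using self_adjoint_eigenvector[of S ?H] S by blast
  obtain l where l: "l\<^sup>2 - of_real c * l + 1 = (0::complex)"
  proof -
    let ?r = "csqrt ((of_real c)\<^sup>2 - 4)"
    have "((of_real c + ?r) / 2)\<^sup>2 - of_real c * ((of_real c + ?r) / 2) + 1 = (?r\<^sup>2 - (of_real c)\<^sup>2 + 4) / 4"
      by (simp add: field_simps power2_eq_square del: power2_csqrt)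
    then show thesis
      by (intro that[of "(of_real c + ?r) / 2"]) simp
  qed
  have UU: "U *v (conj_transpose U *v x) = x"
    using U by (simp add: matrix_vector_mul_assoc unitary_def)
  have "U *v (U *v x + conj_transpose U *v x) = c *\<^sub>R (U *v x)"
    unfolding x(3) by (rule linear_scale[OF matrix_vector_mul_linear])
  then have quad: "U *v (U *v x) = of_real c *s (U *v x) - x"
    by (simp add: UU matrix_vector_right_distrib vec_eq_iff
        scaleR_conv_of_real[where 'a = complex] eq_diff_eq)
  have eig: thesis if y: "y \<in> S" "y \<noteq> 0" "U *v y = k *s y" for y k
  proof -
    have "cmod k * norm y = norm y"
      using norm_unitary_vector[OF U, of y] y(3)
      by (simp add: norm_vector_smult)
    then have "cmod k = 1"
      using y(2) by simp
    moreover have "U *v (of_real (1 / norm y) *s y) = k *s (of_real (1 / norm y) *s y)"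
      by (simp add: y(3) vector_scalar_commute vector_smult_assoc mult.commute)
    moreover have "norm (of_real (1 / norm y) *s y) = 1"
      using y(2) by (simp add: norm_vector_smult norm_divide)
    ultimately show thesis
      using found S(2)[OF y(1)] by blast
  qed
  show thesis
  proof (cases "U *v x = l *s x")
    case True
    then show thesis
      using eig x by force
  next
    case False
    let ?y = "U *v x - l *s x"
    have "?y \<in> S"
      by (intro subspace_diff S inv x)
    moreover have "U *v ?y = (of_real c - l) *s ?y"
    proof -
      have l_inverse: "(of_real c - l) * l = 1"
        using l by (simp add: algebra_simps power2_eq_square add_eq_0_iff)
      have "U *v ?y = (of_real c - l) *s (U *v x) - ((of_real c - l) * l) *s x"
        unfolding l_inverse
        by (simp add: matrix_vector_mult_diff_distrib vector_scalar_commute quad vec_eq_iff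
            algebra_simps)
      also have "\<dots> = (of_real c - l) *s ?y"
        by (simp add: vec_eq_iff algebra_simps)
      finally show ?thesis .
    qed
    moreover have "?y \<noteq> 0"
      using False by simp
    ultimately show thesis
      using eig by blast
  qed
qed

text \<open>Induction over the index set: as long as an index is left over, the orthogonal complement \<open>S\<close> of the
  eigenvectors found so far is nonzero, and it is invariant under \<open>U\<close> and \<open>U\<^sup>*\<close>, hence contains a
  further eigenvector.\<close>
lemma orthonormal_eigenvectors_on:
  fixes U :: "complex^'n^'n" and I :: "'n set"
  assumes U: "unitary U"
  shows "\<exists>v l. (\<forall>i\<in>I. \<forall>j\<in>I. hermitian_product (v i) (v j) = (if i = j then 1 else 0))
     \<and> (\<forall>i\<in>I. U *v v i = l i *s v i \<and> cmod (l i) = 1)"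
proof (induction I rule: finite_induct[OF finite])
  case (2 k I)
  then obtain v l
    where v: "\<And>i j. i \<in> I \<Longrightarrow> j \<in> I \<Longrightarrow> hermitian_product (v i) (v j) = (if i = j then 1 else 0)"
    and l: "\<And>i. i \<in> I \<Longrightarrow> U *v v i = l i *s v i" "\<And>i. i \<in> I \<Longrightarrow> cmod (l i) = 1"
    by metis
  define S where "S = {x. \<forall>i\<in>I. hermitian_product (v i) x = 0}"
  define f where "f x = (\<chi> i. if i \<in> I then hermitian_product (v i) x else 0)" for x
  have scale: "c *\<^sub>R x = of_real c *s x" for c and x :: "complex^'n"
    by (simp add: vec_eq_iff scaleR_conv_of_real[where 'a = complex])
  have "linear f"
    by (intro linearI)
      (simp_all add: f_def vec_eq_iff hermitian_product_sesquilinear scale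
        scaleR_conv_of_real[where 'a = complex])
  \<comment> \<open>The kernel of \<open>f\<close> is \<open>S\<close>. It is nonzero, as the image of \<open>f\<close> misses the direction \<open>k\<close>.\<close>
  moreover have "\<not> surj f"
  proof
    assume "surj f"
    then obtain x where "f x = axis k 1" by (metis surjD)
    then have "f x $ k = 1" by (simp add: axis_def)
    then show False using \<open>k \<notin> I\<close> by (simp add: f_def)
  qed
  ultimately have "\<not> inj f"
    using linear_injective_imp_surjective by blast
  then obtain x where "f x = 0" "x \<noteq> 0"
    using linear_injective_0[OF \<open>linear f\<close>] by blast
  then have nonzero: "\<exists>x\<in>S. x \<noteq> 0"
    by (intro bexI[of _ x]) (auto simp: S_def f_def vec_eq_iff split: if_splits)
  have sub: "subspace S"
    unfolding subspace_def
    by (simp add: S_def hermitian_product_sesquilinear scale) (simp add: hermitian_product_def)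
  have smult: "c *s x \<in> S" if "x \<in> S" for c x
    using that by (simp add: S_def hermitian_product_sesquilinear)
  have UU: "conj_transpose U *v (U *v y) = y" for y
    using U by (simp add: matrix_vector_mul_assoc unitary_def)
  have adj: "v i = l i *s (conj_transpose U *v v i)" "l i \<noteq> 0" if "i \<in> I" for i
    using UU[of "v i"] l[OF that] by (auto simp: vector_scalar_commute)
  have inv: "U *v x \<in> S" "conj_transpose U *v x \<in> S" if x: "x \<in> S" for x
  proof -
    have "hermitian_product (v i) (U *v x) = 0" if i: "i \<in> I" for i
    proof -
      have "cnj (l i) * hermitian_product (v i) (U *v x)
          = hermitian_product (l i *s (conj_transpose U *v v i)) x"
        by (simp add: hermitian_product_sesquilinear hermitian_product_matrix)
      also have "\<dots> = 0"
        using adj(1)[OF i] x i by (simp add: S_def)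
      finally show ?thesis
        using adj(2)[OF i] by simp
    qed
    then show "U *v x \<in> S"
      by (simp add: S_def)
    have "hermitian_product (v i) (conj_transpose U *v x) = 0" if i: "i \<in> I" for i
      using x i by (simp add: hermitian_product_matrix l hermitian_product_sesquilinear S_def)
    then show "conj_transpose U *v x \<in> S"
      by (simp add: S_def)
  qed
  obtain x m where x: "x \<in> S" "norm x = 1" "U *v x = m *s x" "cmod m = 1"
    using unitary_eigenvector[OF U sub smult nonzero inv] by blast
  have "hermitian_product x x = 1"
    by (simp add: hermitian_product_self x)
  moreover have "hermitian_product (v i) x = 0 \<and> hermitian_product x (v i) = 0" if "i \<in> I" for i
    using that x(1) hermitian_product_commute[of x "v i"] by (simp add: S_def)
  ultimately show ?case
    using v l x \<open>k \<notin> I\<close>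
    by (intro exI[of _ "v(k := x)"] exI[of _ "l(k := m)"]) auto
qed simp

lemma unitary_diagonalization:
  fixes U :: "complex^'n^'n"
  assumes "unitary U"
  obtains V a where "unitary V" "\<And>i. \<bar>a i\<bar> \<le> pi" "U = unitary_conjugate V (\<lambda>i. cis (a i))"
proof -
  obtain v :: "'n \<Rightarrow> complex^'n" and l
    where v: "\<And>i j. hermitian_product (v i) (v j) = (if i = j then 1 else 0)"
    and l: "\<And>i. U *v v i = l i *s v i" "\<And>i. cmod (l i) = 1"
    using orthonormal_eigenvectors_on[OF assms, of UNIV] by (metis UNIV_I)
  define V :: "complex^'n^'n" where "V = (\<chi> r c. v c $ r)"
  have "(conj_transpose V ** V) $ i $ j = hermitian_product (v i) (v j)" for i j
    by (simp add: V_def conj_transpose_def matrix_matrix_mult_def hermitian_product_def)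
  then have "conj_transpose V ** V = mat 1"
    by (simp add: vec_eq_iff v mat_def)
  then have V: "unitary V"
    unfolding unitary_def using matrix_left_right_inverse by blast
  have "l i \<noteq> 0" for i using l(2)[of i] by auto
  then have cis: "cis (Arg (l i)) = l i" for i
    using l(2)[of i] by (simp add: cis_Arg sgn_div_norm)
  have "(U ** V) $ r $ c = (V ** diagonal (\<lambda>i. cis (Arg (l i)))) $ r $ c" for r c
  proof -
    have "(U ** V) $ r $ c = (U *v v c) $ r"
      by (simp add: V_def matrix_matrix_mult_def matrix_vector_mult_def)
    then show ?thesis
      by (simp add: l mult_diagonal_entry cis V_def)
  qed
  then have "U ** V = V ** diagonal (\<lambda>i. cis (Arg (l i)))"
    by (simp add: vec_eq_iff)
  then have "U = unitary_conjugate V (\<lambda>i. cis (Arg (l i)))"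
    unfolding unitary_conjugate_def using V
    by (metis matrix_mul_assoc matrix_mul_rid unitary_def)
  moreover have "\<bar>Arg (l i)\<bar> \<le> pi" for i
    using Arg_bounded[of "l i"] by linarith
  ultimately show thesis
    using V by (intro that[of V "\<lambda>i. Arg (l i)"])
qed

text \<open>The angles cannot be chosen as continuous functions of \<open>U\<close>, but any choice will do: the estimates
  below compare two unitary matrices through arbitrary diagonalizations of each.\<close>
lemma unitary_diagonalization_choice:
  obtains V :: "complex^'n^'n \<Rightarrow> complex^'n^'n" and a
  where "\<And>U. unitary U \<Longrightarrow> unitary (V U)"
    and "\<And>U i. unitary U \<Longrightarrow> \<bar>a U i\<bar> \<le> pi"
    and "\<And>U. unitary U \<Longrightarrow> U = unitary_conjugate (V U) (\<lambda>i. cis (a U i))"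
proof -
  have "\<forall>U :: complex^'n^'n. \<exists>V a. unitary U \<longrightarrow>
      unitary V \<and> (\<forall>i. \<bar>a i\<bar> \<le> pi) \<and> U = unitary_conjugate V (\<lambda>i. cis (a i))"
    using unitary_diagonalization by metis
  then obtain V :: "complex^'n^'n \<Rightarrow> complex^'n^'n" and a
    where V: "\<And>U. unitary U \<Longrightarrow> unitary (V U)"
    and a: "\<And>U i. unitary U \<Longrightarrow> \<bar>a U i\<bar> \<le> pi"
    and eq: "\<And>U. unitary U \<Longrightarrow> U = unitary_conjugate (V U) (\<lambda>i. cis (a U i))"
    by metis
  then show thesis
    by (rule that)
qed

section \<open>The contraction and the logarithm\<close>

lemma cmod_cis_diff: "cmod (cis a - cis b) = 2 * \<bar>sin ((a - b) / 2)\<bar>"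
proof -
  have "(cmod (cis a - cis b))\<^sup>2 = (cos a - cos b)\<^sup>2 + (sin a - sin b)\<^sup>2"
    by (simp add: cmod_power2)
  also have "\<dots> = 2 - 2 * cos (a - b)"
    using sin_cos_squared_add[of a] sin_cos_squared_add[of b]
    by (simp add: cos_diff power2_diff algebra_simps)
  also have "\<dots> = (2 * \<bar>sin ((a - b) / 2)\<bar>)\<^sup>2"
    using cos_double_sin[of "(a - b) / 2"] by (simp add: power_mult_distrib diff_divide_distrib)
  finally show ?thesis
    by (rule power2_eq_imp_eq) auto
qed

lemma cmod_cis_diff_le: "cmod (cis a - cis b) \<le> \<bar>a - b\<bar>"
  using abs_sin_x_le_abs_x[of "(a - b) / 2"] by (simp add: cmod_cis_diff)

text \<open>Concavity of the sine on \<open>[0, \<pi>]\<close>, between \<open>0\<close> and \<open>x\<close>.\<close>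
lemma mult_sin_le_sin_mult:
  fixes s x :: real
  assumes "0 \<le> s" "s \<le> 1" "0 \<le> x" "x \<le> pi"
  shows "s * sin x \<le> sin (s * x)"
proof -
  have "concave_on {0..pi} sin"
    unfolding concave_on_def
  proof (rule f''_ge0_imp_convex)
    show "((\<lambda>x. - sin x) has_real_derivative - cos x) (at x)" for x :: real
      by (auto intro!: derivative_eq_intros)
    show "((\<lambda>x. - cos x) has_real_derivative sin x) (at x)" for x :: real
      by (auto intro!: derivative_eq_intros)
  qed (auto intro: sin_ge_zero)
  then have "(1 - s) * sin 0 + s * sin x \<le> sin ((1 - s) *\<^sub>R 0 + s *\<^sub>R x)"
    using assms by (intro concave_onD) auto
  then show ?thesis
    by simp
qed

text \<open>Scaling all angles by \<open>s\<close> shrinks chords at most by the factor \<open>s\<close>. This holds although the two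
  angles may be as far as \<open>2 \<pi>\<close> apart, since the sine is applied to half of their difference, which
  is at most \<open>\<pi>\<close>.\<close>
lemma cmod_cis_diff_shrink:
  assumes s: "0 \<le> s" "s \<le> 1" and ab: "\<bar>a\<bar> \<le> pi" "\<bar>b\<bar> \<le> pi"
  shows "s * cmod (cis a - cis b) \<le> cmod (cis (s * a) - cis (s * b))"
proof -
  let ?x = "\<bar>(a - b) / 2\<bar>"
  have x: "0 \<le> ?x" "?x \<le> pi" using ab by auto
  have "\<bar>sin y\<bar> = sin \<bar>y\<bar>" if "\<bar>y\<bar> \<le> pi" for y :: real
  proof (cases "0 \<le> y")
    case True then show ?thesis using that sin_ge_zero[of y] by simp
  next
    case False then show ?thesis using that sin_ge_zero[of "- y"] by simp
  qed
  moreover have "\<bar>s * ((a - b) / 2)\<bar> = s * ?x" using s by (simp add: abs_mult)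
  moreover have "s * ?x \<le> pi" using mult_mono[of s 1 ?x pi] s x by simp
  ultimately show ?thesis
    using mult_sin_le_sin_mult[OF s x] x
    by (simp add: cmod_cis_diff right_diff_distrib diff_divide_distrib)
qed

text \<open>Multiplying all angles by \<open>s\<close>, that is, mapping \<open>exp(iH)\<close> with \<open>\<parallel>H\<parallel> \<le> \<pi>\<close> to \<open>exp(isH)\<close>, squeezes the
  whole group into a neighbourhood of the identity of radius \<open>s \<pi>\<close>, while distances shrink at most
  by the factor \<open>s\<close>. This is the reason why a ball of radius \<open>s \<pi>\<close> occupies at least the fraction
  \<open>s\<^bsup>N\<^sup>2\<^esup>\<close> of the group.\<close>
lemma unitary_contraction:
  assumes s: "0 \<le> s" "s \<le> 1"
  obtains C :: "complex^'n^'n \<Rightarrow> complex^'n^'n"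
  where "\<And>U. unitary U \<Longrightarrow> unitary (C U)"
    and "\<And>U x. unitary U \<Longrightarrow> norm (C U *v x - x) \<le> s * pi * norm x"
    and "\<And>U W. unitary U \<Longrightarrow> unitary W \<Longrightarrow> s * norm (U - W) \<le> norm (C U - C W)"
proof -
  obtain V :: "complex^'n^'n \<Rightarrow> complex^'n^'n" and a
    where V: "\<And>U. unitary U \<Longrightarrow> unitary (V U)"
    and a: "\<And>U i. unitary U \<Longrightarrow> \<bar>a U i\<bar> \<le> pi"
    and eq: "\<And>U. unitary U \<Longrightarrow> U = unitary_conjugate (V U) (\<lambda>i. cis (a U i))"
    by (rule unitary_diagonalization_choice[where 'n = 'n]) (rule that)
  define C where "C U = unitary_conjugate (V U) (\<lambda>i. cis (s * a U i))" for U
  show thesis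
  proof (rule that[of C])
    show "unitary (C U)" if "unitary U" for U
      unfolding C_def by (intro unitary_unitary_conjugate V that) simp
    show "norm (C U *v x - x) \<le> s * pi * norm x" if U: "unitary U" for U x
      unfolding C_def
    proof (rule norm_unitary_conjugate_vector_diff_le[OF V[OF U]])
      have "cmod (cis (s * a U i) - cis 0) \<le> \<bar>s * a U i - 0\<bar>" for i
        by (rule cmod_cis_diff_le)
      also have "\<bar>s * a U i - 0\<bar> \<le> s * pi" for i
        using s a[OF U, of i] by (simp add: abs_mult mult_left_mono)
      finally show "cmod (cis (s * a U i) - 1) \<le> s * pi" for i
        by simp
    qed (use s in simp)
    show "s * norm (U - W) \<le> norm (C U - C W)" if UW: "unitary U" "unitary W" for U W
    proof (cases "s = 0")
      case False
      then have "0 < s" using s by simp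
      have "norm (unitary_conjugate (V U) (\<lambda>i. cis (a U i)) - unitary_conjugate (V W) (\<lambda>i. cis (a W i)))
        \<le> 1 / s * norm (C U - C W)"
        unfolding C_def
      proof (rule norm_unitary_conjugate_diff_mono)
        show "cmod (cis (a U i) - cis (a W j)) \<le> 1 / s * cmod (cis (s * a U i) - cis (s * a W j))" for i j
          using cmod_cis_diff_shrink[OF s a[OF UW(1)] a[OF UW(2)], of i j] \<open>0 < s\<close>
          by (simp add: field_simps)
      qed (use V UW s in auto)
      then show ?thesis
        using \<open>0 < s\<close> eq[OF UW(1)] eq[OF UW(2)] by (simp add: field_simps)
    qed simp
  qed
qed

text \<open>The exponential \<open>H \<mapsto> exp(iH)\<close> is 1-Lipschitz for the Frobenius norm, because \<open>a \<mapsto> exp(ia)\<close> is.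
  Hence its right inverse \<open>L\<close>, taken with angles in \<open>[-\<pi>, \<pi>]\<close>, maps a separated set of unitary
  matrices to a separated bounded set of Hermitian matrices.\<close>
lemma unitary_logarithm:
  obtains L :: "complex^'n^'n \<Rightarrow> complex^'n^'n"
  where "\<And>U. unitary U \<Longrightarrow> conj_transpose (L U) = L U"
    and "\<And>U. unitary U \<Longrightarrow> norm (L U) \<le> pi * sqrt CARD('n)"
    and "\<And>U W. unitary U \<Longrightarrow> unitary W \<Longrightarrow> norm (U - W) \<le> norm (L U - L W)"
proof -
  obtain V :: "complex^'n^'n \<Rightarrow> complex^'n^'n" and a
    where V: "\<And>U. unitary U \<Longrightarrow> unitary (V U)"
    and a: "\<And>U i. unitary U \<Longrightarrow> \<bar>a U i\<bar> \<le> pi"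
    and eq: "\<And>U. unitary U \<Longrightarrow> U = unitary_conjugate (V U) (\<lambda>i. cis (a U i))"
    by (rule unitary_diagonalization_choice[where 'n = 'n]) (rule that)
  define L where "L U = unitary_conjugate (V U) (\<lambda>i. of_real (a U i))" for U
  show thesis
  proof (rule that[of L])
    show "conj_transpose (L U) = L U" for U
      by (simp add: L_def unitary_conjugate_def conj_transpose_mult conj_transpose_diagonal matrix_mul_assoc)
    show "norm (L U) \<le> pi * sqrt CARD('n)" if U: "unitary U" for U
    proof (rule power2_le_imp_le)
      have "norm (L U) = norm (diagonal (\<lambda>i. of_real (a U i)))"
        unfolding L_def unitary_conjugate_def
        by (simp add: norm_unitary_mult_right norm_unitary_mult_left unitary_conj_transpose V U)
      then have "(norm (L U))\<^sup>2
          = (\<Sum>i\<in>UNIV. \<Sum>j\<in>UNIV. (cmod (diagonal (\<lambda>i. of_real (a U i)) $ i $ j))\<^sup>2)"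
        by (simp only: norm_matrix_squared)
      also have "\<dots> = (\<Sum>i\<in>UNIV. \<Sum>j\<in>UNIV. if i = j then (a U i)\<^sup>2 else 0)"
        by (intro sum.cong refl) (simp add: diagonal_def)
      also have "\<dots> \<le> (\<Sum>i\<in>(UNIV::'n set). pi\<^sup>2)"
        using power_mono[OF a[OF U] abs_ge_zero, where n = 2] by (intro sum_mono) simp
      finally show "(norm (L U))\<^sup>2 \<le> (pi * sqrt CARD('n))\<^sup>2"
        by (simp add: power_mult_distrib mult.commute)
    qed simp
    show "norm (U - W) \<le> norm (L U - L W)" if UW: "unitary U" "unitary W" for U W
    proof -
      have "norm (unitary_conjugate (V U) (\<lambda>i. cis (a U i)) - unitary_conjugate (V W) (\<lambda>i. cis (a W i)))
        \<le> 1 * norm (L U - L W)"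
        unfolding L_def
      proof (rule norm_unitary_conjugate_diff_mono)
        show "cmod (cis (a U i) - cis (a W j)) \<le> 1 * cmod (of_real (a U i) - of_real (a W j))" for i j
          using cmod_cis_diff_le[of "a U i" "a W j"] by (simp flip: of_real_diff)
      qed (use V UW in auto)
      then show ?thesis
        using eq[OF UW(1)] eq[OF UW(2)] by simp
    qed
  qed
qed

section \<open>Packings of the unitary group\<close>

text \<open>Hermitian matrices form a real vector space of dimension \<open>N\<^sup>2\<close>; this encoding in the real matrices
  is isometric. An entry and its mirror image carry \<open>Re + Im\<close> and \<open>Re - Im\<close>, and
  \<open>(Re + Im)\<^sup>2 + (Re - Im)\<^sup>2 = 2 Re\<^sup>2 + 2 Im\<^sup>2\<close>.\<close>
definition real_encoding :: "complex^'n^'n \<Rightarrow> real^'n^'n" where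
  "real_encoding H = (\<chi> i j. Re (H $ i $ j) + Im (H $ i $ j))"

lemma norm_real_encoding:
  assumes "conj_transpose H = H"
  shows "norm (real_encoding H) = norm H"
proof -
  have H: "H $ j $ i = cnj (H $ i $ j)" for i j
    using arg_cong[OF assms, of "\<lambda>A. A $ j $ i"] by (simp add: conj_transpose_def)
  let ?c = "\<lambda>i j. Re (H $ i $ j) * Im (H $ i $ j)"
  have "(\<Sum>i\<in>UNIV. \<Sum>j\<in>UNIV. ?c i j) = (\<Sum>i\<in>UNIV. \<Sum>j\<in>UNIV. ?c j i)"
    by (rule sum.swap)
  also have "\<dots> = (\<Sum>i\<in>UNIV. \<Sum>j\<in>UNIV. - ?c i j)"
    by (intro sum.cong refl) (metis H cnj.sel mult_minus_right)
  also have "\<dots> = - (\<Sum>i\<in>UNIV. \<Sum>j\<in>UNIV. ?c i j)"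
    by (simp add: sum_negf)
  finally have "(\<Sum>i\<in>UNIV. \<Sum>j\<in>UNIV. 2 * ?c i j) = 0"
    by (simp flip: sum_distrib_left)
  moreover have "(norm (real_encoding H))\<^sup>2
      = (\<Sum>i\<in>UNIV. \<Sum>j\<in>UNIV. (cmod (H $ i $ j))\<^sup>2 + 2 * ?c i j)"
    by (simp add: norm_matrix_squared real_encoding_def cmod_power2 power2_sum mult.assoc)
  ultimately have "(norm (real_encoding H))\<^sup>2 = (norm H)\<^sup>2"
    by (simp add: norm_matrix_squared sum.distrib)
  then show ?thesis by simp
qed

text \<open>Two matrices whose entries lie in the same cells of a grid of width \<open>h = e / N\<close> are less than \<open>e\<close>
  apart. So distinct elements of \<open>S\<close> occupy distinct cells of this grid in \<open>[-r, r]\<^bsup>N\<^sup>2\<^esup>\<close>.\<close>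
lemma separated_real_matrices_card_le:
  fixes S :: "'a set" and f :: "'a \<Rightarrow> real^'n^'n" and e r :: real
  assumes "0 < e" "0 \<le> r" "\<And>x. x \<in> S \<Longrightarrow> norm (f x) \<le> r"
    and sep: "\<And>x y. x \<in> S \<Longrightarrow> y \<in> S \<Longrightarrow> x \<noteq> y \<Longrightarrow> e \<le> norm (f x - f y)"
  shows "card S \<le> (2 * r * CARD('n) / e + 2) ^ (CARD('n)\<^sup>2)"
proof -
  define N where "N = CARD('n)"
  define h where "h = e / N"
  have N: "N > 0" by (simp add: N_def)
  have h: "h > 0" using N assms(1) by (simp add: h_def)
  let ?I = "{\<lfloor>- r / h\<rfloor>..\<lfloor>r / h\<rfloor>}"
  let ?g = "\<lambda>x (i, j). \<lfloor>f x $ i $ j / h\<rfloor>"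
  let ?F = "Pi\<^sub>E (UNIV :: ('n \<times> 'n) set) (\<lambda>_. ?I)"
  have "inj_on ?g S"
  proof (rule inj_onI, rule ccontr)
    fix x y assume xy: "x \<in> S" "y \<in> S" "?g x = ?g y" "x \<noteq> y"
    have lt: "\<bar>(f x - f y) $ i $ j\<bar> < h" for i j
    proof -
      have "\<lfloor>f x $ i $ j / h\<rfloor> = \<lfloor>f y $ i $ j / h\<rfloor>"
        using fun_cong[OF xy(3), of "(i, j)"] by simp
      then have "\<bar>f x $ i $ j / h - f y $ i $ j / h\<bar> < 1"
        by linarith
      then show ?thesis
        using h by (simp add: diff_divide_distrib[symmetric] abs_divide)
    qed
    have "(norm (f x - f y))\<^sup>2 = (\<Sum>i\<in>UNIV. \<Sum>j\<in>UNIV. ((f x - f y) $ i $ j)\<^sup>2)"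
      by (simp add: norm_matrix_squared)
    also have "\<dots> < (\<Sum>i\<in>(UNIV::'n set). \<Sum>j\<in>(UNIV::'n set). h\<^sup>2)"
      using power_strict_mono[OF lt abs_ge_zero, where n = 2] by (intro sum_strict_mono) (simp_all del: vector_minus_component)
    also have "\<dots> = e\<^sup>2"
      using N by (simp add: h_def N_def power_divide power2_eq_square)
    finally have "norm (f x - f y) < e"
      using assms(1) by (simp add: power2_less_imp_less)
    then show False
      using sep[OF xy(1,2,4)] by simp
  qed
  moreover have "?g ` S \<subseteq> ?F"
  proof -
    have "\<bar>f x $ i $ j\<bar> \<le> r" if "x \<in> S" for x i j
      using Finite_Cartesian_Product.norm_nth_le[of "f x $ i" j]
        Finite_Cartesian_Product.norm_nth_le[of "f x" i] assms(3)[OF that]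
      by simp
    then have "- r / h \<le> f x $ i $ j / h \<and> f x $ i $ j / h \<le> r / h" if "x \<in> S" for x i j
      using that h by (intro conjI divide_right_mono) (simp_all add: abs_le_iff minus_le_iff)
    then have "?g x p \<in> ?I" if "x \<in> S" for x p
      using that by (cases p) (simp add: floor_mono)
    then show ?thesis
      by (auto simp: PiE_UNIV_domain)
  qed
  moreover have "finite ?F"
    by (intro finite_PiE) auto
  ultimately have "card S \<le> card ?F"
    by (intro card_inj_on_le)
  also have "card ?F = nat (\<lfloor>r / h\<rfloor> - \<lfloor>- r / h\<rfloor> + 1) ^ N\<^sup>2"
    by (simp add: card_PiE N_def power2_eq_square)
  finally have "real (card S) \<le> real (nat (\<lfloor>r / h\<rfloor> - \<lfloor>- r / h\<rfloor> + 1)) ^ N\<^sup>2"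
    by (metis of_nat_le_iff of_nat_power)
  also have "\<dots> \<le> (2 * r / h + 2) ^ N\<^sup>2"
  proof (intro power_mono)
    have "0 \<le> r / h" using h assms(2) by simp
    then show "real (nat (\<lfloor>r / h\<rfloor> - \<lfloor>- r / h\<rfloor> + 1)) \<le> 2 * r / h + 2"
      by linarith
  qed simp
  finally show ?thesis
    by (simp add: h_def N_def)
qed

text \<open>The unitary group has box dimension at most \<open>N\<^sup>2\<close>: apply the grid bound to encoded logarithms.\<close>
lemma separated_unitary_family_card_le:
  fixes S :: "(complex^'n^'n) set"
  assumes "0 < e" "\<And>U. U \<in> S \<Longrightarrow> unitary U"
    and sep: "\<And>U W. U \<in> S \<Longrightarrow> W \<in> S \<Longrightarrow> U \<noteq> W \<Longrightarrow> e \<le> norm (U - W)"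
  shows "card S \<le> (2 * (pi * sqrt CARD('n)) * CARD('n) / e + 2) ^ (CARD('n)\<^sup>2)"
proof -
  obtain L :: "complex^'n^'n \<Rightarrow> complex^'n^'n"
    where herm: "\<And>U. unitary U \<Longrightarrow> conj_transpose (L U) = L U"
      and bound: "\<And>U. unitary U \<Longrightarrow> norm (L U) \<le> pi * sqrt CARD('n)"
      and le: "\<And>U W. unitary U \<Longrightarrow> unitary W \<Longrightarrow> norm (U - W) \<le> norm (L U - L W)"
    by (rule unitary_logarithm[where 'n = 'n]) (rule that)
  show ?thesis
  proof (rule separated_real_matrices_card_le[where f = "\<lambda>U. real_encoding (L U)"])
    show "norm (real_encoding (L U)) \<le> pi * sqrt CARD('n)" if "U \<in> S" for U
      using that by (simp add: norm_real_encoding herm bound assms)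
    show "e \<le> norm (real_encoding (L U) - real_encoding (L W))"
      if UW: "U \<in> S" "W \<in> S" "U \<noteq> W" for U W
    proof -
      have u: "unitary U" "unitary W" using UW assms by auto
      have "conj_transpose (L U - L W) = conj_transpose (L U) - conj_transpose (L W)"
        by (simp add: conj_transpose_def vec_eq_iff)
      then have "norm (real_encoding (L U - L W)) = norm (L U - L W)"
        by (intro norm_real_encoding) (simp add: herm u)
      moreover have "real_encoding (L U) - real_encoding (L W) = real_encoding (L U - L W)"
        by (simp add: real_encoding_def vec_eq_iff)
      ultimately show ?thesis
        using sep[OF UW] le[OF u] by simp
    qed
  qed (use assms in auto)
qed

text \<open>A self-similar family: \<open>M = card I\<close> contracted copies of a separated set are moved to the centres
  \<open>g i\<close>. Within a copy the separation drops at most by the factor \<open>s\<close>. Points of different copies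
  stay \<open>\<eta>\<close> apart, since the centres are \<open>2 \<pi> s + \<eta>\<close> apart and each copy has radius at most \<open>s \<pi>\<close>.\<close>
lemma separated_translates:
  fixes g :: "'i \<Rightarrow> complex^'n^'n" and s \<eta> :: real
  assumes "finite I" and g: "\<And>i. i \<in> I \<Longrightarrow> unitary (g i)"
    and s: "0 < s" "s \<le> 1" and "0 < \<eta>"
    and sep: "\<And>i j. i \<in> I \<Longrightarrow> j \<in> I \<Longrightarrow> i \<noteq> j
      \<Longrightarrow> \<exists>x. norm x = 1 \<and> 2 * pi * s + \<eta> \<le> norm (g i *v x - g j *v x)"
  shows "\<exists>S :: (complex^'n^'n) set. finite S \<and> card S = card I ^ k \<and> (\<forall>U\<in>S. unitary U)
    \<and> (\<forall>U\<in>S. \<forall>W\<in>S. U \<noteq> W \<longrightarrow> \<eta> * s ^ k \<le> norm (U - W))"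
proof (induction k)
  case 0
  show ?case
    by (intro exI[of _ "{mat 1}"]) simp
next
  case (Suc k)
  then obtain S :: "(complex^'n^'n) set" where S: "finite S" "card S = card I ^ k" "\<And>U. U \<in> S \<Longrightarrow> unitary U"
    and Ssep: "\<And>U W. U \<in> S \<Longrightarrow> W \<in> S \<Longrightarrow> U \<noteq> W \<Longrightarrow> \<eta> * s ^ k \<le> norm (U - W)"
    by blast
  obtain C :: "complex^'n^'n \<Rightarrow> complex^'n^'n"
    where C: "\<And>U. unitary U \<Longrightarrow> unitary (C U)"
      and C_near: "\<And>U x. unitary U \<Longrightarrow> norm (C U *v x - x) \<le> s * pi * norm x"
      and C_shrink: "\<And>U W. unitary U \<Longrightarrow> unitary W \<Longrightarrow> s * norm (U - W) \<le> norm (C U - C W)"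
    by (rule unitary_contraction[OF less_imp_le[OF s(1)] s(2), where 'n = 'n]) (rule that)
  let ?f = "\<lambda>(i, U). g i ** C U"
  have fsep: "\<eta> * s ^ Suc k \<le> norm (g i ** C U - g j ** C W)"
    if ij: "i \<in> I" "j \<in> I" and UW: "U \<in> S" "W \<in> S" and ne: "(i, U) \<noteq> (j, W)" for i j U W
  proof (cases "i = j")
    case True
    have "\<eta> * s ^ Suc k \<le> s * norm (U - W)"
      using Ssep[OF UW] True ne s by (simp add: mult.left_commute)
    also have "\<dots> \<le> norm (C U - C W)"
      by (intro C_shrink S UW)
    also have "\<dots> = norm (g i ** (C U - C W))"
      by (simp add: norm_unitary_mult_left g ij)
    finally show ?thesis
      using True by (simp add: matrix_diff_distribs)
  next
    case False
    then obtain x where x: "norm x = 1" "2 * pi * s + \<eta> \<le> norm (g i *v x - g j *v x)"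
      using sep[OF ij] by blast
    \<comment> \<open>Test the difference on the vector \<open>x\<close> that witnesses the distance of the two centres.\<close>
    have "(g i ** C U - g j ** C W) *v x
        = (g i *v x - g j *v x) + g i *v (C U *v x - x) - g j *v (C W *v x - x)"
      by (simp add: matrix_vector_mult_diff_distrib matrix_vector_mult_diff_rdistrib matrix_vector_mul_assoc)
    then have "g i *v x - g j *v x
        = (g i ** C U - g j ** C W) *v x - g i *v (C U *v x - x) + g j *v (C W *v x - x)"
      by simp
    then have "norm (g i *v x - g j *v x) \<le> norm ((g i ** C U - g j ** C W) *v x)
        + norm (g i *v (C U *v x - x)) + norm (g j *v (C W *v x - x))"
      by (smt (verit) norm_triangle_ineq norm_triangle_ineq4)
    also have "norm (g i *v (C U *v x - x)) \<le> s * pi"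
      using C_near[of U x] S UW x by (simp add: norm_unitary_vector g ij)
    also have "norm (g j *v (C W *v x - x)) \<le> s * pi"
      using C_near[of W x] S UW x by (simp add: norm_unitary_vector g ij)
    also have "norm ((g i ** C U - g j ** C W) *v x) \<le> norm (g i ** C U - g j ** C W)"
      using norm_matrix_vector_le[of "g i ** C U - g j ** C W" x] x by simp
    finally have "\<eta> \<le> norm (g i ** C U - g j ** C W)"
      using x(2) by (simp add: algebra_simps)
    moreover have "\<eta> * s ^ Suc k \<le> \<eta> * 1"
      using s \<open>0 < \<eta>\<close> by (intro mult_left_mono power_le_one) auto
    ultimately show ?thesis
      by simp
  qed
  have pos: "0 < \<eta> * s ^ Suc k"
    using s \<open>0 < \<eta>\<close> by simp
  have "inj_on ?f (I \<times> S)"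
  proof (rule inj_onI, rule ccontr)
    fix p q assume pq: "p \<in> I \<times> S" "q \<in> I \<times> S" "?f p = ?f q" "p \<noteq> q"
    then show False
      using fsep[of "fst p" "fst q" "snd p" "snd q"] pos by (auto simp: case_prod_beta)
  qed
  then have "card (?f ` (I \<times> S)) = card I ^ Suc k"
    by (simp add: card_image card_cartesian_product S)
  moreover have "finite (?f ` (I \<times> S))"
    using S \<open>finite I\<close> by simp
  moreover have "\<forall>U\<in>?f ` (I \<times> S). unitary U"
    by (auto intro!: unitary_mult[OF g C[OF S(3)]])
  moreover have "\<forall>U\<in>?f ` (I \<times> S). \<forall>W\<in>?f ` (I \<times> S). U \<noteq> W \<longrightarrow> \<eta> * s ^ Suc k \<le> norm (U - W)"
  proof (intro ballI impI)
    fix X Y assume "X \<in> ?f ` (I \<times> S)" "Y \<in> ?f ` (I \<times> S)" and ne: "X \<noteq> Y"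
    then obtain i U j W where "i \<in> I" "U \<in> S" "X = g i ** C U" "j \<in> I" "W \<in> S" "Y = g j ** C W"
      by auto
    then show "\<eta> * s ^ Suc k \<le> norm (X - Y)"
      using fsep ne by blast
  qed
  ultimately show ?case
    by blast
qed

text \<open>The packing bound limits the \<open>M\<^sup>k\<close> points at mutual distance \<open>\<eta> s\<^sup>k\<close> of the self-similar family to
  a constant times \<open>s\<^bsup>-k N\<^sup>2\<^esup>\<close>, the constant being independent of \<open>k\<close>. The powers of \<open>M s\<^bsup>N\<^sup>2\<^esup>\<close> are
  therefore bounded, which is possible only if this number is at most \<open>1\<close>.\<close>
lemma separated_family_volume_bound:
  fixes g :: "'i \<Rightarrow> complex^'n^'n" and s \<eta> :: real
  assumes "finite I" and g: "\<And>i. i \<in> I \<Longrightarrow> unitary (g i)"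
    and s: "0 < s" "s \<le> 1" and "0 < \<eta>"
    and sep: "\<And>i j. i \<in> I \<Longrightarrow> j \<in> I \<Longrightarrow> i \<noteq> j
      \<Longrightarrow> \<exists>x. norm x = 1 \<and> 2 * pi * s + \<eta> \<le> norm (g i *v x - g j *v x)"
  shows "card I * s ^ (CARD('n)\<^sup>2) \<le> 1"
proof -
  define N where "N = CARD('n)"
  define D where "D = 2 * (pi * sqrt N) * N / \<eta>"
  have "D \<ge> 0" using \<open>0 < \<eta>\<close> by (simp add: D_def)
  have "(card I * s ^ N\<^sup>2) ^ k \<le> (D + 2) ^ N\<^sup>2" for k
  proof -
    have "\<exists>S :: (complex^'n^'n) set. finite S \<and> card S = card I ^ k \<and> (\<forall>U\<in>S. unitary U)
        \<and> (\<forall>U\<in>S. \<forall>W\<in>S. U \<noteq> W \<longrightarrow> \<eta> * s ^ k \<le> norm (U - W))"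
      by (rule separated_translates[where I = I and g = g]) (use assms in blast)+
    then obtain S :: "(complex^'n^'n) set" where S: "card S = card I ^ k" "\<And>U. U \<in> S \<Longrightarrow> unitary U"
      "\<And>U W. U \<in> S \<Longrightarrow> W \<in> S \<Longrightarrow> U \<noteq> W \<Longrightarrow> \<eta> * s ^ k \<le> norm (U - W)"
      by blast
    have "real (card S) \<le> (D / s ^ k + 2) ^ N\<^sup>2"
      using separated_unitary_family_card_le[of "\<eta> * s ^ k" S] S s \<open>0 < \<eta>\<close>
      by (simp add: N_def D_def)
    moreover have "(s ^ N\<^sup>2) ^ k = (s ^ k) ^ N\<^sup>2"
      by (metis mult.commute power_mult)
    ultimately have "(card I * s ^ N\<^sup>2) ^ k \<le> (D / s ^ k + 2) ^ N\<^sup>2 * (s ^ k) ^ N\<^sup>2"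
      using s by (simp add: S power_mult_distrib mult_right_mono)
    also have "\<dots> = (D + 2 * s ^ k) ^ N\<^sup>2"
      using s by (simp add: power_mult_distrib[symmetric] algebra_simps)
    also have "\<dots> \<le> (D + 2) ^ N\<^sup>2"
      using s \<open>D \<ge> 0\<close> by (intro power_mono add_left_mono) (auto simp: power_le_one)
    finally show ?thesis .
  qed
  then have "\<not> 1 < card I * s ^ N\<^sup>2"
    using real_arch_pow[of "card I * s ^ N\<^sup>2" "(D + 2) ^ N\<^sup>2"] by (meson not_le)
  then show ?thesis
    by (simp add: N_def)
qed

section \<open>Products of powers of two unitary matrices\<close>

lemma unitary_int_pow:
  assumes "unitary A"
  shows "unitary (A [^]\<^bsub>unitary_group\<^esub> (j :: int))"
  using group.int_pow_closed[OF group_unitary_group, of A j] assms by simp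

theorem theorem2:
  fixes A B :: "complex^'n^'n" and J K :: nat
  assumes "A \<in> carrier unitary_group" and "B \<in> carrier unitary_group"
    and "J > 0" and "K > 0"
  shows "\<delta> J K A B \<le> 2 * pi * (real J + 1) powr (- 1 / (real CARD('n))\<^sup>2)
                          * (real K + 1) powr (- 1 / (real CARD('n))\<^sup>2)"
proof (rule ccontr)
  interpret group "unitary_group :: (complex^'n^'n) monoid"
    by (rule group_unitary_group)
  define N where "N = CARD('n)"
  define I where "I = {0..int J} \<times> {0..int K}"
  define g where "g = (\<lambda>(j, k). A [^]\<^bsub>unitary_group\<^esub> (j::int) ** B [^]\<^bsub>unitary_group\<^esub> (k::int))"
  define s\<^sub>0 where "s\<^sub>0 = (real J + 1) powr (- 1 / (real N)\<^sup>2) * (real K + 1) powr (- 1 / (real N)\<^sup>2)"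
  assume "\<not> ?thesis"
  then have "2 * pi * s\<^sub>0 < \<delta> J K A B"
    by (simp add: s\<^sub>0_def N_def mult.assoc)
  then have s0_less: "s\<^sub>0 < \<delta> J K A B / (2 * pi)"
    by (simp add: field_simps)
  have N: "N > 0" by (simp add: N_def)
  have card: "real (card I) = (real J + 1) * (real K + 1)"
    by (simp add: I_def card_cartesian_product)
  have "s\<^sub>0 > 0" by (simp add: s\<^sub>0_def)
  have "s\<^sub>0 = real (card I) powr (- 1 / (real N)\<^sup>2)"
    unfolding card s\<^sub>0_def by (simp add: powr_mult)
  then have "s\<^sub>0 powr real (N\<^sup>2) = real (card I) powr - 1"
    using N by (simp add: powr_powr)
  then have s0_pow: "s\<^sub>0 ^ N\<^sup>2 = 1 / real (card I)"
    unfolding powr_realpow[OF \<open>s\<^sub>0 > 0\<close>] using card by (simp add: powr_minus_divide)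
  have "1 < real (card I)"
    unfolding card using assms(3,4) by (simp add: algebra_simps add_pos_pos)
  then have "s\<^sub>0 ^ N\<^sup>2 < 1"
    by (simp add: s0_pow)
  then have "s\<^sub>0 < 1"
    by (meson not_le one_le_power)
  \<comment> \<open>A value strictly above \<open>s\<^sub>0\<close> contradicts the volume bound; one strictly below
    \<open>\<delta> / (2 \<pi>)\<close> leaves room for the gap \<open>\<eta>\<close>.\<close>
  then obtain s where s: "s\<^sub>0 < s" "s < 1" "s < \<delta> J K A B / (2 * pi)"
    using dense[of "s\<^sub>0" "min 1 (\<delta> J K A B / (2 * pi))"] s0_less by auto
  define \<eta> where "\<eta> = (\<delta> J K A B - 2 * pi * s) / 2"
  have \<eta>: "0 < \<eta>" "2 * pi * s + \<eta> < \<delta> J K A B"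
    using s(3) by (simp_all add: \<eta>_def field_simps)
  have sep: "\<exists>x. norm x = 1 \<and> 2 * pi * s + \<eta> \<le> norm (g p *v x - g q *v x)"
    if pq: "p \<in> I" "q \<in> I" "p \<noteq> q" for p q
  proof -
    obtain j k j' k' where p: "p = (j, k)" and q: "q = (j', k')"
      by (metis surj_pair)
    let ?A = "\<lambda>j::int. A [^]\<^bsub>unitary_group\<^esub> j" and ?B = "\<lambda>k::int. B [^]\<^bsub>unitary_group\<^esub> k"
    let ?X = "?A (j - j') ** ?B (k - k')"
    have "(j - j', k - k') \<in> exponent_pairs J K"
      using pq by (auto simp: p q I_def exponent_pairs_def)
    then have "\<phi> ?X \<in> (\<lambda>(j, k). \<phi> (?A j \<otimes>\<^bsub>unitary_group\<^esub> ?B k)) ` exponent_pairs J K"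
      by (auto intro!: rev_image_eqI)
    then have "\<delta> J K A B \<le> \<phi> ?X"
      unfolding \<delta>_def by (intro Min_le finite_imageI finite_exponent_pairs)
    then have "2 * pi * s + \<eta> < \<phi> ?X"
      using \<eta> by simp
    then obtain y where y: "norm y = 1" "2 * pi * s + \<eta> < norm (?X *v y - y)"
      unfolding \<phi>_def using less_cSUP_iff[OF unit_vectors_nonempty bdd_above_displacement, of _ ?X] by auto
    \<comment> \<open>Chosen so that \<open>g p x - g q x = A\<^bsup>j'\<^esup> (A\<^bsup>j - j'\<^esup> B\<^bsup>k - k'\<^esup> y - y)\<close>.\<close>
    let ?x = "?B (- k') *v y"
    have A: "?A j = ?A j' ** ?A (j - j')"
      using int_pow_mult[of A j' "j - j'"] assms by simp
    have B: "?B (k - k') = ?B k ** ?B (- k')" "?B k' ** ?B (- k') = mat 1"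
      using int_pow_mult[of B k "- k'"] int_pow_mult[of B k' "- k'"] assms by simp_all
    have "g p *v ?x - g q *v ?x = ?A j' *v (?X *v y - y)"
      unfolding p q g_def case_prod_conv
      by (simp add: matrix_vector_mult_diff_distrib matrix_vector_mul_assoc A B
          matrix_mul_assoc[symmetric])
    then have "norm (g p *v ?x - g q *v ?x) = norm (?X *v y - y)"
      using assms by (simp add: norm_unitary_vector unitary_int_pow)
    moreover have "norm ?x = 1"
      using assms y by (simp add: norm_unitary_vector unitary_int_pow)
    ultimately show ?thesis
      using y(2) by (intro exI[of _ ?x]) simp
  qed
  have "card I * s ^ N\<^sup>2 \<le> 1"
    unfolding N_def
  proof (rule separated_family_volume_bound[where g = g and \<eta> = \<eta>])
    show "unitary (g p)" if "p \<in> I" for p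
      using assms by (auto simp: g_def case_prod_beta intro!: unitary_mult unitary_int_pow)
  qed (use s \<open>s\<^sub>0 > 0\<close> \<eta> sep in \<open>auto simp: I_def\<close>)
  moreover have "s\<^sub>0 ^ N\<^sup>2 < s ^ N\<^sup>2"
    using s \<open>s\<^sub>0 > 0\<close> N by (intro power_strict_mono) auto
  ultimately show False
    using s0_pow \<open>1 < real (card I)\<close> by (simp add: field_simps)
qed

end
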